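(* Let $k\ge 1$ be an integer, let $G_1=(V_1,E_1,w_1)$ and $G_2=(V_2,E_2,w_2)$ be weighted graphs, and let $G=(V,E,w)=G_1+G_2$ be their sum. Let $p$ be a $k$-partition of $V$ such that the restriction $p_{|V_1}$ is an optimum Max $k$-Cut solution for $G_1$ and the restriction $p_{|V_2}$ is an optimum Max $k$-Cut solution for $G_2$. Then $p$ is an optimum Max $k$-Cut solution for $G$.
   Context: A weighted graph $G=(V,E,w)$ is a finite simple undirected graph with edge weights $w:E\to\mathbb{R}$ (possibly negative). A $k$-partition of a set $M$ is a function $p:M\to\{1,\dots,k\}$; for $S\subseteq M$, $p_{|S}$ is its restriction to $S$. For a $k$-partition $p$ of $V$, the induced $k$-cut is $\delta_G(p)=\{\{u,v\}\in E : p(u)\neq p(v)\}$ and $w(p)=\sum_{e\in\delta_G(p)}w(e)$. An optimum (Max $k$-Cut) solution for $G$ is a $k$-partition of $V$ maximizing $w(p)$ among all $k$-partitions of $V$. The vertex sets $V_1,V_2$ may overlap. The sum $G_1+G_2$ is the weighted graph $(V,E,w)$ with $V=V_1\cup V_2$, $E=E_1\cup E_2$ and $w(e)=w_1(e)+w_2(e)$ if $e\in E_1\cap E_2$, $w(e)=w_1(e)$ if $e\in E_1\setminus E_2$, and $w(e)=w_2(e)$ if $e\in E_2\setminus E_1$. *)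

theory Defs
  imports Complex_Main "HOL-Library.FuncSet"
begin

(* Edges are two-element vertex sets. The weight function is total; its values outside the
   edge set carry no information and enter none of the notions below. *)
record 'a wgraph =
  verts :: "'a set"
  edges :: "'a set set"
  weight :: "'a set \<Rightarrow> real"

definition weighted_graph :: "'a wgraph \<Rightarrow> bool" where
  "weighted_graph G \<longleftrightarrow>
     finite (verts G) \<and> (\<forall>e\<in>edges G. e \<subseteq> verts G \<and> card e = 2)"

definition graph_sum :: "'a wgraph \<Rightarrow> 'a wgraph \<Rightarrow> 'a wgraph" where
  "graph_sum G1 G2 =
     \<lparr>verts = verts G1 \<union> verts G2,
      edges = edges G1 \<union> edges G2,
      weight = (\<lambda>e. if e \<in> edges G1 \<inter> edges G2 then weight G1 e + weight G2 e
                    else if e \<in> edges G1 then weight G1 e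
                    else weight G2 e)\<rparr>"

(* Extensional functions, so that the elements are exactly the maps from M to {1, ..., k}.
   A k-partition may leave some classes empty. *)
definition k_partitions :: "nat \<Rightarrow> 'a set \<Rightarrow> ('a \<Rightarrow> nat) set" where
  "k_partitions k M = M \<rightarrow>\<^sub>E {1..k}"

definition cut :: "'a wgraph \<Rightarrow> ('a \<Rightarrow> nat) \<Rightarrow> 'a set set" where
  "cut G p = {{u, v} | u v. {u, v} \<in> edges G \<and> p u \<noteq> p v}"

definition cut_weight :: "'a wgraph \<Rightarrow> ('a \<Rightarrow> nat) \<Rightarrow> real" where
  "cut_weight G p = (\<Sum>e\<in>cut G p. weight G e)"

definition optimum_k_cut :: "nat \<Rightarrow> 'a wgraph \<Rightarrow> ('a \<Rightarrow> nat) \<Rightarrow> bool" where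
  "optimum_k_cut k G p \<longleftrightarrow>
     p \<in> k_partitions k (verts G) \<and>
     (\<forall>q\<in>k_partitions k (verts G). cut_weight G q \<le> cut_weight G p)"

lemma weighted_graph_graph_sum:
  assumes "weighted_graph G1" and "weighted_graph G2"
  shows "weighted_graph (graph_sum G1 G2)"
  using assms by (auto simp: weighted_graph_def graph_sum_def)

end

theory Submission
  imports Defs
begin

text \<open>For a fixed partition, the cut weight is additive under graph sums
  (\<open>cut_weight_graph_sum\<close>): an edge present in both graphs is cut in both or in
  neither, and its weights add up. Each summand sees only the labels on the vertices of its own
  graph, so any competitor \<open>q\<close> on the union restricts to a competitor on each part,
  where it cannot beat \<open>p\<close> (\<open>cut_weight_le_if_optimum_restrict\<close>). Adding
  the two inequalities gives optimality on the sum.\<close>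

lemma finite_cut:
  assumes "weighted_graph G"
  shows "finite (cut G p)"
proof (rule finite_subset)
  show "cut G p \<subseteq> Pow (verts G)"
    using assms by (force simp: cut_def weighted_graph_def)
  show "finite (Pow (verts G))"
    using assms by (simp add: weighted_graph_def)
qed

text \<open>Both endpoints of an edge are vertices, so labels outside \<open>verts G\<close> never
  matter. This lets a labelling of a larger set be evaluated on \<open>G\<close> directly.\<close>

lemma cut_restrict_verts:
  assumes "weighted_graph G"
  shows "cut G (restrict p (verts G)) = cut G p"
proof -
  have "u \<in> verts G \<and> v \<in> verts G" if "{u, v} \<in> edges G" for u v
    using assms that by (force simp: weighted_graph_def)
  then show ?thesis
    unfolding cut_def by (intro Collect_cong) (metis restrict_apply')
qed

lemma cut_weight_restrict_verts:
  assumes "weighted_graph G"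
  shows "cut_weight G (restrict p (verts G)) = cut_weight G p"
  by (simp add: cut_weight_def cut_restrict_verts[OF assms])

lemma cut_graph_sum: "cut (graph_sum G1 G2) p = cut G1 p \<union> cut G2 p"
  by (auto simp: cut_def graph_sum_def)

lemma cut_weight_graph_sum:
  assumes "weighted_graph G1" and "weighted_graph G2"
  shows "cut_weight (graph_sum G1 G2) p = cut_weight G1 p + cut_weight G2 p"
proof -
  let ?C = "cut G1 p \<union> cut G2 p"
  have fin: "finite ?C"
    using assms by (simp add: finite_cut)
  have weight: "weight (graph_sum G1 G2) e =
      (if e \<in> cut G1 p then weight G1 e else 0) + (if e \<in> cut G2 p then weight G2 e else 0)"
    if "e \<in> ?C" for e
  proof -
    \<comment> \<open>Being cut depends only on the labels of the endpoints of \<open>e\<close>, not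
      on the graph. As \<open>e\<close> is already cut in one graph, membership in the other cut
      reduces to membership in its edge set, which matches the case distinction in
      \<open>graph_sum\<close>.\<close>
    have "e \<in> cut G1 p \<longleftrightarrow> e \<in> edges G1" "e \<in> cut G2 p \<longleftrightarrow> e \<in> edges G2"
      using that by (auto simp: cut_def)
    with that show ?thesis
      by (auto simp: graph_sum_def)
  qed
  have "cut_weight (graph_sum G1 G2) p =
      (\<Sum>e\<in>?C. if e \<in> cut G1 p then weight G1 e else 0) +
      (\<Sum>e\<in>?C. if e \<in> cut G2 p then weight G2 e else 0)"
    by (simp add: cut_weight_def cut_graph_sum weight sum.distrib)
  also have "\<dots> = cut_weight G1 p + cut_weight G2 p"
    \<comment> \<open>Each indicator sum over \<open>?C\<close> collapses to a sum over the
      intersection of \<open>?C\<close> with one cut, which is that cut itself.\<close>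
    using sum.inter_restrict[OF fin, of "weight G1" "cut G1 p"]
      sum.inter_restrict[OF fin, of "weight G2" "cut G2 p"]
    by (simp add: cut_weight_def Int_absorb1)
  finally show ?thesis .
qed

lemma restrict_k_partitions:
  assumes "p \<in> k_partitions k M" and "S \<subseteq> M"
  shows "restrict p S \<in> k_partitions k S"
  using assms by (auto simp: k_partitions_def)

text \<open>The restriction of \<open>q\<close> is an admissible competitor on \<open>G\<close>, and
  restricting changes neither of the two cut weights.\<close>

lemma cut_weight_le_if_optimum_restrict:
  assumes "weighted_graph G" and "optimum_k_cut k G (restrict p (verts G))"
    and "q \<in> k_partitions k M" and "verts G \<subseteq> M"
  shows "cut_weight G q \<le> cut_weight G p"
  using assms restrict_k_partitions[OF assms(3,4)]
  by (metis cut_weight_restrict_verts optimum_k_cut_def)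

theorem theorem8:
  fixes k :: nat and G1 G2 G :: "'a wgraph" and p :: "'a \<Rightarrow> nat"
  assumes "k \<ge> 1"
    and "weighted_graph G1" and "weighted_graph G2"
    and "G = graph_sum G1 G2"
    and "p \<in> k_partitions k (verts G)"
    and "optimum_k_cut k G1 (restrict p (verts G1))"
    and "optimum_k_cut k G2 (restrict p (verts G2))"
  shows "optimum_k_cut k G p"
proof -
  have "cut_weight G q \<le> cut_weight G p" if q: "q \<in> k_partitions k (verts G)" for q
  proof -
    have "verts G1 \<subseteq> verts G" "verts G2 \<subseteq> verts G"
      using assms(4) by (auto simp: graph_sum_def)
    then have "cut_weight G1 q \<le> cut_weight G1 p" "cut_weight G2 q \<le> cut_weight G2 p"
      using assms q cut_weight_le_if_optimum_restrict by blast+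
    then show ?thesis
      using assms(2-4) by (simp add: cut_weight_graph_sum)
  qed
  with assms(5) show ?thesis
    by (simp add: optimum_k_cut_def)
qed

end
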